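(* Let $\varphi_1:\mathbb{N}\to\mathbb{N}$ be the function defined as follows. The values $\varphi_1(0),\varphi_1(1),\dots,\varphi_1(13)$ are, in order, $$2,3,0,1,5,4,9,8,7,6,13,12,11,10.$$ (1) If $7\cdot 2^{2n-1}\le x<7\cdot 2^{2n}$ for some integer $n\ge 1$, then $\varphi_1(x)=x\oplus 1$. (2) If $7\cdot 2^{2n}\le x<7\cdot 2^{2n+1}$ for some integer $n\ge1$, then $\varphi_1(x)=x\oplus 3$. Then, for all nonnegative integers $a,b$, the Halve Nim position $a^1b^11^1$ is a $\mathcal{P}$-position if and only if $b=\varphi_1(a)$. Furthermore, for $a,b\ge 14$, $a^1b^11^1$ is a $\mathcal{P}$-position if and only if $$a\oplus b=2+(-1)^{\lfloor\log_2(a/7)\rfloor}.$$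
   Context: $\mathbb{N}$ is the set of nonnegative integers and $\oplus$ denotes bitwise XOR. Halve Nim is a two-player game played on finitely many piles of coins; players alternate moves and a player who cannot move loses. A move is one of: (i) choose one pile and remove at least one coin from it; (ii) halve the game: simultaneously replace every pile of $m$ coins by a pile of $\lfloor m/2\rfloor$ coins. When there are no coins left, no move is available (halving requires at least one coin to be present). A position is a $\mathcal{P}$-position if the player who is not about to move has a winning strategy (equivalently, every move from it leads to an $\mathcal{N}$-position), and an $\mathcal{N}$-position if the player about to move has a winning strategy. $a^1b^1c^1$ denotes the position with three piles of sizes $a$, $b$, $c$ (a pile of size $0$ is an empty pile); in particular $a^1b^11^1$ has piles of sizes $a$, $b$, $1$. *)

theory Defs
  imports Complex_Main "HOL-Library.Multiset"
begin

unbundle bit_operations_syntax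

text \<open>A position is the multiset of its pile sizes. Exhausted piles stay in the multiset as
  entries \<open>0\<close>; they admit no removal and do not count as coins for halving.\<close>

type_synonym position = "nat multiset"

inductive halve_nim_move :: "position \<Rightarrow> position \<Rightarrow> bool" where
  remove: "k < m \<Longrightarrow> halve_nim_move (add_mset m M) (add_mset k M)"
| halve: "\<exists>m \<in># M. 0 < m \<Longrightarrow> halve_nim_move M (image_mset (\<lambda>m. m div 2) M)"

text \<open>A derivation of \<open>N_position p\<close> (of \<open>P_position p\<close>) is a winning strategy for the player
  who is (is not) about to move: it supplies a reply to each move of the opponent. As derivations
  are well-founded, such a strategy wins after finitely many moves, and it wins
  because the opponent cannot move.\<close>

inductive P_position :: "position \<Rightarrow> bool" and N_position :: "position \<Rightarrow> bool" where
  P: "\<forall>q. halve_nim_move p q \<longrightarrow> N_position q \<Longrightarrow> P_position p"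
| N: "halve_nim_move p q \<Longrightarrow> P_position q \<Longrightarrow> N_position p"

lemma halve_nim_move_decreases:
  assumes "halve_nim_move p q"
  shows "sum_mset q < sum_mset p"
  using assms
proof cases
  case (halve)
  then obtain m M where "p = add_mset m M" "0 < m"
    by (metis multi_member_split)
  moreover have "(\<Sum>x\<in>#M. x div 2) \<le> sum_mset M"
    by (induction M) (auto intro: add_mono)
  moreover have "m div 2 < m" using \<open>0 < m\<close> by simp
  ultimately show ?thesis
    using halve by (simp add: add_less_le_mono)
qed simp

lemma N_position_iff: "N_position p \<longleftrightarrow> \<not> P_position p"
proof (induction p rule: measure_induct_rule[of sum_mset])
  case (less p)
  then show ?case
    by (meson halve_nim_move_decreases N_position.simps P_position.simps)
qed

text \<open>The last branch is never reached: the intervals \<open>[7 * 2 ^ k, 7 * 2 ^ (k + 1))\<close> with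
  \<open>k \<ge> 1\<close> cover all \<open>x \<ge> 14\<close>. Their parities of \<open>k\<close> make the two conditions exclusive.\<close>

definition phi1 :: "nat \<Rightarrow> nat" where
  "phi1 x =
    (if x < 14 then [2, 3, 0, 1, 5, 4, 9, 8, 7, 6, 13, 12, 11, 10] ! x
     else if \<exists>n\<ge>1. 7 * 2 ^ (2 * n - 1) \<le> x \<and> x < 7 * 2 ^ (2 * n) then x XOR 1
     else if \<exists>n\<ge>1. 7 * 2 ^ (2 * n) \<le> x \<and> x < 7 * 2 ^ (2 * n + 1) then x XOR 3
     else undefined)"

end

theory Submission
  imports Defs
begin

text \<open>Everything rests on the two-pile game. Its \<open>\<P>\<close>-positions are again the pairs
  \<open>(a, phi0 a)\<close> for an involution \<open>phi0\<close>, which for \<open>a \<ge> 14\<close> alternates between \<open>a\<close> and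
  \<open>a XOR 2\<close> on the intervals \<open>[7 * 2 ^ k, 7 * 2 ^ (k + 1))\<close>. Both involutions are verified
  with the same criterion: the graph of an involution \<open>f\<close> is the set of \<open>\<P>\<close>-positions as
  soon as, apart from removals from the piles \<open>a\<close> and \<open>b\<close>, no move leads from the graph to a
  \<open>\<P>\<close>-position, and every pair below the graph (\<open>a < f b\<close> and \<open>b < f a\<close>) has such a move.
  For \<open>a \<ge> 14\<close> the involutions preserve the blocks \<open>{4 * q..<4 * q + 4}\<close>, so only the two
  low bits matter.\<close>

section \<open>Moves with three piles\<close>

lemma P_position_iff: "P_position p \<longleftrightarrow> (\<forall>q. halve_nim_move p q \<longrightarrow> \<not> P_position q)"
  using N_position_iff by (metis P_position.simps)

text \<open>The two-pile game is the case \<open>c = 0\<close>, so one list of moves serves both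
  games.\<close>

lemma halve_nim_move_triple:
  "halve_nim_move {#a, b, c#} q \<longleftrightarrow>
    (\<exists>k<a. q = {#k, b, c#}) \<or> (\<exists>k<b. q = {#a, k, c#}) \<or> (\<exists>k<c. q = {#a, b, k#}) \<or>
    ((0 < a \<or> 0 < b \<or> 0 < c) \<and> q = {#a div 2, b div 2, c div 2#})"
  (is "?L \<longleftrightarrow> ?R")
proof
  assume ?L
  then show ?R
  proof cases
    case (remove k m M)
    then have "m \<in># {#a, b, c#}" "M = {#a, b, c#} - {#m#}"
      by (metis union_single_eq_member, metis add_mset_remove_trivial)
    with remove show ?thesis
      by (auto simp: add_mset_commute)
  next
    case halve
    then show ?thesis by auto
  qed
next
  assume ?R
  then consider k where "k < a" "q = {#k, b, c#}" | k where "k < b" "q = {#a, k, c#}"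
    | k where "k < c" "q = {#a, b, k#}"
    | "0 < a \<or> 0 < b \<or> 0 < c" "q = {#a div 2, b div 2, c div 2#}"
    by blast
  then show ?L
  proof cases
    case 1
    then show ?thesis by (simp add: halve_nim_move.remove)
  next
    case (2 k)
    then show ?thesis
      using halve_nim_move.remove[of k b "{#a, c#}"] by (simp add: add_mset_commute)
  next
    case (3 k)
    then show ?thesis
      using halve_nim_move.remove[of k c "{#a, b#}"] by (simp add: add_mset_commute)
  next
    case 4
    then show ?thesis
      using halve_nim_move.halve[of "{#a, b, c#}"] by auto
  qed
qed

lemma P_position_triple_iff:
  "P_position {#a, b, c#} \<longleftrightarrow>
    (\<forall>k<a. \<not> P_position {#k, b, c#}) \<and> (\<forall>k<b. \<not> P_position {#a, k, c#}) \<and>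
    (\<forall>k<c. \<not> P_position {#a, b, k#}) \<and>
    (0 < a \<or> 0 < b \<or> 0 < c \<longrightarrow> \<not> P_position {#a div 2, b div 2, c div 2#})"
  unfolding P_position_iff[of "{#a, b, c#}"] halve_nim_move_triple by blast

text \<open>\<open>H a b\<close> is meant as a move to a P-position other than a removal from the
  first two piles, so the right side is the recursion for P-positions. If
  \<open>b \<noteq> f a\<close>, then either such a removal reaches the graph, or
  \<open>a < f b\<close> and \<open>b < f a\<close>, where \<open>H\<close> holds.\<close>

lemma involution_graph_iff:
  fixes f :: "nat \<Rightarrow> nat"
  assumes "\<And>a. f (f a) = a"
    and "\<And>a. \<not> H a (f a)"
    and "\<And>a b. a < f b \<Longrightarrow> b < f a \<Longrightarrow> H a b"
  shows "b = f a \<longleftrightarrow> (\<forall>k<a. b \<noteq> f k) \<and> (\<forall>k<b. k \<noteq> f a) \<and> \<not> H a b"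
proof
  assume "b = f a"
  then show "(\<forall>k<a. b \<noteq> f k) \<and> (\<forall>k<b. k \<noteq> f a) \<and> \<not> H a b"
    using assms(1,2) by (metis less_irrefl)
next
  assume R: "(\<forall>k<a. b \<noteq> f k) \<and> (\<forall>k<b. k \<noteq> f a) \<and> \<not> H a b"
  then consider "f b \<le> a" | "f a \<le> b"
    using assms(3) not_le by blast
  then show "b = f a"
  proof cases
    case 1
    moreover have "\<not> f b < a" using R assms(1)[of b] by metis
    ultimately show ?thesis using assms(1)[of b] by simp
  next
    case 2
    then show ?thesis using R by (auto simp: le_less)
  qed
qed

section \<open>The intervals between the points \<open>7 * 2 ^ k\<close>\<close>

text \<open>For \<open>x \<ge> 14\<close> this says that \<open>\<lfloor>log 2 (x / 7)\<rfloor>\<close> is even.\<close>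

fun even_level :: "nat \<Rightarrow> bool" where
  "even_level x = (if 28 \<le> x then \<not> even_level (x div 2) else False)"

declare even_level.simps [simp del]

lemma even_level_small: "x < 28 \<Longrightarrow> \<not> even_level x"
  by (simp add: even_level.simps)

lemma even_level_ge_28: "28 \<le> x \<Longrightarrow> even_level x \<longleftrightarrow> \<not> even_level (x div 2)"
  by (subst even_level.simps) simp

text \<open>As 4 divides 28, no block of four straddles the base case, and halving maps a block into
  a block.\<close>

lemma even_level_block: "x div 4 = y div 4 \<Longrightarrow> even_level x \<longleftrightarrow> even_level y"
proof (induction x arbitrary: y rule: less_induct)
  case (less x)
  show ?case
  proof (cases "x < 28")
    case True
    then have "y < 28" using less.prems by presburger
    with True show ?thesis by (simp add: even_level_small)
  next
    case False
    then have "28 \<le> y" using less.prems by presburger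
    moreover have "x div 2 div 4 = y div 2 div 4"
      using less.prems by (metis div_mult2_eq mult.commute)
    then have "even_level (x div 2) = even_level (y div 2)"
      using False by (intro less.IH) auto
    ultimately show ?thesis using False by (simp add: even_level_ge_28)
  qed
qed

lemma even_level_iff_even:
  "1 \<le> k \<Longrightarrow> 7 * 2 ^ k \<le> x \<Longrightarrow> x < 7 * 2 ^ (k + 1) \<Longrightarrow> even_level x \<longleftrightarrow> even k"
proof (induction k arbitrary: x rule: dec_induct)
  case base
  then show ?case by (simp add: even_level_small)
next
  case (step k)
  have "2 ^ 1 \<le> (2::nat) ^ k" using step.hyps by (intro power_increasing) auto
  then have "28 \<le> x" using step.prems by simp
  moreover have "even_level (x div 2) \<longleftrightarrow> even k"
    using step.prems by (intro step.IH) auto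
  ultimately show ?case by (simp add: even_level_ge_28)
qed

lemma level_exists:
  fixes x :: nat
  assumes "14 \<le> x"
  shows "\<exists>k\<ge>1. 7 * 2 ^ k \<le> x \<and> x < 7 * 2 ^ (k + 1)"
  using assms
proof (induction x rule: less_induct)
  case (less x)
  show ?case
  proof (cases "x < 28")
    case True
    with less.prems show ?thesis by (intro exI[of _ 1]) simp
  next
    case False
    then obtain k where "k \<ge> 1" "7 * 2 ^ k \<le> x div 2" "x div 2 < 7 * 2 ^ (k + 1)"
      using less.IH[of "x div 2"] less.prems by force
    then show ?thesis by (intro exI[of _ "Suc k"]) auto
  qed
qed

lemma phi1_ge_14:
  assumes "14 \<le> x"
  shows "phi1 x = x XOR (if even_level x then 3 else 1)"
proof -
  have A: "\<not> even_level x"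
    if "n \<ge> 1" "7 * 2 ^ (2 * n - 1) \<le> x" "x < 7 * 2 ^ (2 * n)" for n
    using that even_level_iff_even[of "2 * n - 1" x] by auto
  have B: "even_level x"
    if "n \<ge> 1" "7 * 2 ^ (2 * n) \<le> x" "x < 7 * 2 ^ (2 * n + 1)" for n
    using that even_level_iff_even[of "2 * n" x] by auto
  obtain k where k: "k \<ge> 1" "7 * 2 ^ k \<le> x" "x < 7 * 2 ^ (k + 1)"
    using level_exists[OF assms] by blast
  show ?thesis
  proof (cases "even k")
    case True
    then obtain n where "k = 2 * n" by blast
    with k have n: "\<exists>n\<ge>1. 7 * 2 ^ (2 * n) \<le> x \<and> x < 7 * 2 ^ (2 * n + 1)"
      by (intro exI[of _ n]) auto
    with B have "even_level x" by blast
    with A n assms show ?thesis unfolding phi1_def by auto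
  next
    case False
    then obtain n where "k = 2 * n + 1" by (blast elim: oddE)
    \<comment> \<open>The witness is \<open>Suc n\<close> because \<open>k = 2 * n + 1\<close> has
      to be read as \<open>2 * Suc n - 1\<close>.\<close>
    with k have n: "\<exists>n\<ge>1. 7 * 2 ^ (2 * n - 1) \<le> x \<and> x < 7 * 2 ^ (2 * n)"
      by (intro exI[of _ "Suc n"]) auto
    with A have "\<not> even_level x" by blast
    with n assms show ?thesis unfolding phi1_def by auto
  qed
qed

text \<open>The floor is the exponent \<open>k\<close> of the interval containing \<open>a\<close>,
  and the power depends only on its parity.\<close>

lemma minus_one_powi_floor_log:
  assumes "14 \<le> a"
  shows "(-1 :: real) powi \<lfloor>log 2 (real a / 7)\<rfloor> = (if even_level a then 1 else - 1)"
proof -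
  obtain k where k: "k \<ge> 1" "7 * 2 ^ k \<le> a" "a < 7 * 2 ^ (k + 1)"
    using level_exists[OF assms] by blast
  have "real (7 * 2 ^ k) \<le> real a" "real a < real (7 * 2 ^ (k + 1))"
    using k by (blast intro: of_nat_mono, blast intro: of_nat_less_iff[THEN iffD2])
  then have "2 ^ k \<le> real a / 7" "real a / 7 < 2 ^ (k + 1)"
    by (simp_all add: field_simps)
  moreover from this have "0 < real a / 7" using assms by simp
  ultimately have "real k \<le> log 2 (real a / 7)" "log 2 (real a / 7) < real (k + 1)"
    by (simp_all only: le_log_iff log_less_iff powr_realpow one_less_numeral_iff semiring_norm
        zero_less_numeral)
  then have "\<lfloor>log 2 (real a / 7)\<rfloor> = int k"
    by (intro floor_unique) simp_all
  then show ?thesis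
    using even_level_iff_even[OF k] by (simp add: power_int_def)
qed

section \<open>The two involutions\<close>

definition phi0 :: "nat \<Rightarrow> nat" where
  "phi0 x = (if x < 14 then [0, 2, 1, 3, 4, 5, 8, 9, 6, 7, 12, 13, 10, 11] ! x
     else x XOR (if even_level x then 2 else 0))"

section \<open>XOR with a mask below 4 and the two low bits\<close>

lemma xor_div_4:
  fixes x c :: nat
  assumes "c < 4"
  shows "(x XOR c) div 4 = x div 4"
proof -
  have "drop_bit 2 (x XOR c) = drop_bit 2 x"
    using assms by (simp add: drop_bit_xor) (simp add: drop_bit_eq_div)
  then show ?thesis by (simp add: drop_bit_eq_div)
qed

lemma xor_block:
  fixes x c :: nat
  assumes "c < 4"
  shows "x XOR c = 4 * (x div 4) + (x mod 4 XOR c)"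
proof -
  have "x XOR c = push_bit 2 (drop_bit 2 (x XOR c)) + take_bit 2 (x XOR c)"
    by (rule bits_ident[symmetric])
  also have "drop_bit 2 (x XOR c) = x div 4"
    using xor_div_4[OF assms] by (simp add: drop_bit_eq_div)
  also have "take_bit 2 (x XOR c) = (x mod 4 XOR c)"
    using assms by (simp add: take_bit_xor) (simp add: take_bit_eq_mod)
  finally show ?thesis by (simp add: push_bit_eq_mult mult.commute)
qed

text \<open>Fixing the residue modulo 4 turns halves and XORs into linear terms in \<open>q\<close>,
  within reach of linear arithmetic.\<close>

lemma low_bits_cases:
  fixes x :: nat
  obtains q where "x = 4 * q" "x div 4 = q" "x div 2 = 2 * q"
      "x XOR 1 = 4 * q + 1" "x XOR 2 = 4 * q + 2" "x XOR 3 = 4 * q + 3"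
  | q where "x = 4 * q + 1" "x div 4 = q" "x div 2 = 2 * q"
      "x XOR 1 = 4 * q" "x XOR 2 = 4 * q + 3" "x XOR 3 = 4 * q + 2"
  | q where "x = 4 * q + 2" "x div 4 = q" "x div 2 = 2 * q + 1"
      "x XOR 1 = 4 * q + 3" "x XOR 2 = 4 * q" "x XOR 3 = 4 * q + 1"
  | q where "x = 4 * q + 3" "x div 4 = q" "x div 2 = 2 * q + 1"
      "x XOR 1 = 4 * q + 2" "x XOR 2 = 4 * q + 1" "x XOR 3 = 4 * q"
proof -
  have x: "x = 4 * (x div 4) + x mod 4" "x div 2 = 2 * (x div 4) + x mod 4 div 2"
    by presburger+
  note xor = xor_block[of 1 x] xor_block[of 2 x] xor_block[of 3 x]
  consider "x mod 4 = 0" | "x mod 4 = 1" | "x mod 4 = 2" | "x mod 4 = 3" by linarith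
  then show thesis
  proof cases
    case 1
    show thesis by (rule that(1)[of "x div 4"]) (use 1 x xor in simp_all)
  next
    case 2
    show thesis by (rule that(2)[of "x div 4"]) (use 2 x xor in simp_all)
  next
    case 3
    show thesis by (rule that(3)[of "x div 4"]) (use 3 x xor in simp_all)
  next
    case 4
    show thesis by (rule that(4)[of "x div 4"]) (use 4 x xor in simp_all)
  qed
qed

lemma phi0_ge_14: "14 \<le> x \<Longrightarrow> phi0 x = x XOR (if even_level x then 2 else 0)"
  by (simp add: phi0_def)

lemma even_level_xor: "c < 4 \<Longrightarrow> even_level (x XOR c) \<longleftrightarrow> even_level x"
  by (intro even_level_block xor_div_4)

lemma even_level_imp: "even_level x \<Longrightarrow> 28 \<le> x \<and> \<not> even_level (x div 2)"
  by (metis even_level_ge_28 even_level_small not_le)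

text \<open>Halving an even level lands in an odd one, still at or above 14, where
  \<open>phi0\<close> is the identity.\<close>

lemma phi_even_level:
  assumes "even_level x"
  shows "phi0 x = x XOR 2" "phi1 x = x XOR 3" "phi0 (x div 2) = x div 2"
proof -
  have "14 \<le> x" "14 \<le> x div 2" "\<not> even_level (x div 2)"
    using even_level_imp[OF assms] by auto
  with assms show "phi0 x = x XOR 2" "phi1 x = x XOR 3" "phi0 (x div 2) = x div 2"
    by (simp_all only: phi0_ge_14 phi1_ge_14 if_True if_False xor.right_neutral)
qed

lemma phi_not_even_level:
  assumes "14 \<le> x" "\<not> even_level x"
  shows "phi0 x = x" "phi1 x = x XOR 1" "phi0 (x div 2) \<noteq> x div 2"
proof -
  show "phi0 x = x" "phi1 x = x XOR 1"
    using assms by (simp_all add: phi0_ge_14 phi1_ge_14)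
  show "phi0 (x div 2) \<noteq> x div 2"
  proof (cases "x < 28")
    case True
    \<comment> \<open>The halves of 14, ..., 27 are 7, ..., 13, and the table of \<open>phi0\<close>
      has no fixed point there.\<close>
    with assms have "x div 2 \<in> {7, 8, 9, 10, 11, 12, 13}" by auto
    then show ?thesis by (auto simp: phi0_def)
  next
    case False
    with assms have "even_level (x div 2)" by (simp add: even_level_ge_28)
    then have "phi0 (x div 2) = x div 2 XOR 2" by (rule phi_even_level)
    then show ?thesis by (cases "x div 2" rule: low_bits_cases) simp_all
  qed
qed

text \<open>Below 14 the hypotheses of the criterion are a finite check; ranging over
  \<open>set [0..<14]\<close> lets \<open>upt_rec\<close> expand the quantifiers into closed
  instances.\<close>

lemma phi_small_table:
  "\<forall>a\<in>set [0..<14]. phi0 a < 14 \<and> phi1 a < 14 \<and> phi0 (phi0 a) = a \<and> phi1 (phi1 a) = a \<and>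
    (0 < a \<or> 0 < phi0 a \<longrightarrow> phi0 a div 2 \<noteq> phi0 (a div 2)) \<and>
    phi1 a \<noteq> phi0 a \<and> phi1 a div 2 \<noteq> phi0 (a div 2) \<and>
    (\<forall>b\<in>set [0..<14].
      (a < phi0 b \<and> b < phi0 a \<longrightarrow> (0 < a \<or> 0 < b) \<and> b div 2 = phi0 (a div 2)) \<and>
      (a < phi1 b \<and> b < phi1 a \<longrightarrow> b = phi0 a \<or> b div 2 = phi0 (a div 2)))"
  by (simp add: phi0_def phi1_def upt_rec)

lemma phi_small:
  assumes "a < 14"
  shows "phi0 a < 14" "phi1 a < 14" "phi0 (phi0 a) = a" "phi1 (phi1 a) = a"
    and "0 < a \<or> 0 < phi0 a \<Longrightarrow> phi0 a div 2 \<noteq> phi0 (a div 2)"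
    and "phi1 a \<noteq> phi0 a" "phi1 a div 2 \<noteq> phi0 (a div 2)"
    and "b < 14 \<Longrightarrow> a < phi0 b \<Longrightarrow> b < phi0 a \<Longrightarrow> (0 < a \<or> 0 < b) \<and> b div 2 = phi0 (a div 2)"
    and "b < 14 \<Longrightarrow> a < phi1 b \<Longrightarrow> b < phi1 a \<Longrightarrow> b = phi0 a \<or> b div 2 = phi0 (a div 2)"
  using bspec[OF phi_small_table, of a] assms by auto

text \<open>On even levels both partners flip bit 1 of \<open>a\<close>, hence change its half,
  which \<open>phi0\<close> fixes; on the others they keep the half, which \<open>phi0\<close>
  moves.\<close>

lemma phi_large:
  assumes "14 \<le> a"
  shows "14 \<le> phi0 a" "14 \<le> phi1 a" "phi0 (phi0 a) = a" "phi1 (phi1 a) = a"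
    and "phi0 a div 2 \<noteq> phi0 (a div 2)"
    and "phi1 a \<noteq> phi0 a" "phi1 a div 2 \<noteq> phi0 (a div 2)"
proof -
  have "14 \<le> phi0 a \<and> 14 \<le> phi1 a \<and> phi0 (phi0 a) = a \<and> phi1 (phi1 a) = a \<and>
    phi0 a div 2 \<noteq> phi0 (a div 2) \<and> phi1 a \<noteq> phi0 a \<and> phi1 a div 2 \<noteq> phi0 (a div 2)"
  proof (cases "even_level a")
    case True
    note E = this phi_even_level[OF True] even_level_imp[OF True]
    have "phi0 (a XOR 2) = a" "phi1 (a XOR 3) = a"
      using True by (simp_all add: phi_even_level even_level_xor xor.assoc)
    with E show ?thesis
      by (cases a rule: low_bits_cases) simp_all
  next
    case False
    note E = assms phi_not_even_level[OF assms False]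
    \<comment> \<open>The block 12, ..., 15 straddles 14, but XOR 1 pairs 14 with 15.\<close>
    have "14 \<le> a XOR 1" using assms by (cases a rule: low_bits_cases) simp_all
    then have "phi1 (a XOR 1) = a"
      using False by (subst phi_not_even_level) (simp_all add: even_level_xor xor.assoc)
    with E \<open>14 \<le> a XOR 1\<close> show ?thesis
      by (cases a rule: low_bits_cases) simp_all
  qed
  then show "14 \<le> phi0 a" "14 \<le> phi1 a" "phi0 (phi0 a) = a" "phi1 (phi1 a) = a"
    "phi0 a div 2 \<noteq> phi0 (a div 2)" "phi1 a \<noteq> phi0 a" "phi1 a div 2 \<noteq> phi0 (a div 2)"
    by blast+
qed

lemma phi_involution: "phi0 (phi0 a) = a" "phi1 (phi1 a) = a"
  using phi_small(3,4) phi_large(3,4) by (metis not_le)+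

lemma phi_div_4:
  assumes "14 \<le> a"
  shows "phi0 a div 4 = a div 4" "phi1 a div 4 = a div 4"
  using assms by (simp_all add: phi0_ge_14 phi1_ge_14 xor_div_4)

text \<open>Both involutions preserve blocks, so the inequalities force \<open>a\<close> and
  \<open>b\<close> into one block, and comparing the two low bits suffices.\<close>

lemma below_phi_large:
  assumes "14 \<le> a" "14 \<le> b"
  shows "a < phi0 b \<Longrightarrow> b < phi0 a \<Longrightarrow> b div 2 = phi0 (a div 2)"
    and "a < phi1 b \<Longrightarrow> b < phi1 a \<Longrightarrow> b = phi0 a \<or> b div 2 = phi0 (a div 2)"
proof -
  have "even_level b = even_level a \<and> a div 4 = b div 4"
    if "a div 4 \<le> b div 4" "b div 4 \<le> a div 4"
    using that even_level_block[of b a] by simp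
  moreover have "a div 4 \<le> b div 4 \<and> b div 4 \<le> a div 4"
    if "a < phi0 b \<and> b < phi0 a \<or> a < phi1 b \<and> b < phi1 a"
    using that assms by (metis phi_div_4 div_le_mono less_imp_le)
  ultimately have block: "even_level b = even_level a \<and> a div 4 = b div 4"
    if "a < phi0 b \<and> b < phi0 a \<or> a < phi1 b \<and> b < phi1 a"
    using that by blast
  show "b div 2 = phi0 (a div 2)" if "a < phi0 b" "b < phi0 a"
  proof (cases "even_level a")
    case True
    with block that have "even_level b" "a div 4 = b div 4" by blast+
    moreover from this that True have "a < b XOR 2" "b < a XOR 2"
      by (simp_all add: phi_even_level)
    \<comment> \<open>The inequalities leave only pairs in the lower half of the block.\<close>
    ultimately have "b div 2 = a div 2"
      by (cases a rule: low_bits_cases; cases b rule: low_bits_cases; linarith)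
    with True show ?thesis by (simp add: phi_even_level)
  next
    case False
    \<comment> \<open>Here \<open>phi0\<close> is the identity, so the two inequalities contradict
      each other.\<close>
    with block that assms show ?thesis by (auto simp: phi_not_even_level)
  qed
  show "b = phi0 a \<or> b div 2 = phi0 (a div 2)" if "a < phi1 b" "b < phi1 a"
  proof (cases "even_level a")
    case True
    with block that have "even_level b" "a div 4 = b div 4" by blast+
    moreover from this that True have "a < b XOR 3" "b < a XOR 3"
      by (simp_all add: phi_even_level)
    \<comment> \<open>Besides equal halves, only the pair \<open>4 * q\<close>,
      \<open>4 * q + 2\<close> survives, in either order.\<close>
    ultimately have "b = a XOR 2 \<or> b div 2 = a div 2"
      by (cases a rule: low_bits_cases; cases b rule: low_bits_cases; linarith)
    with True show ?thesis by (simp add: phi_even_level)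
  next
    case False
    with block that have "\<not> even_level b" "a div 4 = b div 4" by blast+
    \<comment> \<open>Only \<open>b = a\<close> survives, and this is \<open>phi0 a\<close>.\<close>
    with that False assms show ?thesis
      by (cases a rule: low_bits_cases; cases b rule: low_bits_cases)
        (simp_all add: phi_not_even_level)
  qed
qed

text \<open>If one number is below 14, so is its image, which bounds the other. Hence no pair
  straddles 14, and the table and the block analysis together cover all cases.\<close>

lemma below_phi_same_side:
  assumes "a < f b" "b < f a" "\<And>x::nat. x < 14 \<Longrightarrow> f x < (14::nat)"
  shows "a < 14 \<longleftrightarrow> b < 14"
  using assms(1,2) assms(3)[of a] assms(3)[of b] by linarith

section \<open>Positions with a third pile of size 0 or 1\<close>

text \<open>The only extra move is halving; the guard keeps the empty position, where
  \<open>phi0 0 = 0\<close>, from counting as a move to itself.\<close>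

lemma phi0_graph_iff:
  "b = phi0 a \<longleftrightarrow> (\<forall>k<a. b \<noteq> phi0 k) \<and> (\<forall>k<b. k \<noteq> phi0 a) \<and>
    \<not> ((0 < a \<or> 0 < b) \<and> b div 2 = phi0 (a div 2))"
proof (rule involution_graph_iff)
  show "\<not> ((0 < a \<or> 0 < phi0 a) \<and> phi0 a div 2 = phi0 (a div 2))" for a
    using phi_small(5) phi_large(5) by (metis not_le)
  show "(0 < a \<or> 0 < b) \<and> b div 2 = phi0 (a div 2)" if "a < phi0 b" "b < phi0 a" for a b
  proof (cases "a < 14")
    case True
    then have "b < 14" using below_phi_same_side[OF that] phi_small(1) by blast
    with True that show ?thesis by (intro phi_small(8))
  next
    case False
    then have "\<not> b < 14" using below_phi_same_side[OF that] phi_small(1) by blast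
    with False that show ?thesis using below_phi_large(1) by auto
  qed
qed (rule phi_involution)

text \<open>The extra moves are taking the single coin and halving, which also empties the third
  pile. That coin makes halving always possible, hence no guard.\<close>

lemma phi1_graph_iff:
  "b = phi1 a \<longleftrightarrow> (\<forall>k<a. b \<noteq> phi1 k) \<and> (\<forall>k<b. k \<noteq> phi1 a) \<and>
    \<not> (b = phi0 a \<or> b div 2 = phi0 (a div 2))"
proof (rule involution_graph_iff)
  show "\<not> (phi1 a = phi0 a \<or> phi1 a div 2 = phi0 (a div 2))" for a
    using phi_small(6,7) phi_large(6,7) by (metis not_le)
  show "b = phi0 a \<or> b div 2 = phi0 (a div 2)" if "a < phi1 b" "b < phi1 a" for a b
  proof (cases "a < 14")
    case True
    then have "b < 14" using below_phi_same_side[OF that] phi_small(2) by blast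
    with True that show ?thesis by (intro phi_small(9))
  next
    case False
    then have "\<not> b < 14" using below_phi_same_side[OF that] phi_small(2) by blast
    with False that show ?thesis using below_phi_large(2) by auto
  qed
qed (rule phi_involution)

lemma P_position_two_piles: "P_position {#a, b, 0#} \<longleftrightarrow> b = phi0 a"
proof (induction "a + b" arbitrary: a b rule: less_induct)
  case less
  have "P_position {#k, b, 0#} \<longleftrightarrow> b = phi0 k" if "k < a" for k
    using that by (intro less) simp
  moreover have "P_position {#a, k, 0#} \<longleftrightarrow> k = phi0 a" if "k < b" for k
    using that by (intro less) simp
  \<comment> \<open>The presence of a coin makes halving strictly decrease the induction
    measure.\<close>
  moreover have "P_position {#a div 2, b div 2, 0#} \<longleftrightarrow> b div 2 = phi0 (a div 2)"
    if "0 < a \<or> 0 < b"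
    using that by (intro less) linarith
  ultimately show ?case
    unfolding P_position_triple_iff[of a b 0] phi0_graph_iff[of b a] by auto
qed

lemma P_position_third_pile_1: "P_position {#a, b, 1#} \<longleftrightarrow> b = phi1 a"
proof (induction "a + b" arbitrary: a b rule: less_induct)
  case less
  have "P_position {#k, b, 1#} \<longleftrightarrow> b = phi1 k" if "k < a" for k
    using that by (intro less) simp
  moreover have "P_position {#a, k, 1#} \<longleftrightarrow> k = phi1 a" if "k < b" for k
    using that by (intro less) simp
  \<comment> \<open>Since \<open>1 div 2 = 0\<close>, halving falls into the two-pile game, already
    solved.\<close>
  moreover have "P_position {#a div 2, b div 2, 1 div 2#} \<longleftrightarrow> b div 2 = phi0 (a div 2)"
    using P_position_two_piles by simp
  ultimately show ?case
    unfolding P_position_triple_iff[of a b 1] phi1_graph_iff[of b a]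
    by (auto simp: P_position_two_piles)
qed

theorem theorem15:
  fixes a b :: nat
  shows "(P_position {#a, b, 1#} \<longleftrightarrow> b = phi1 a) \<and>
    (14 \<le> a \<and> 14 \<le> b \<longrightarrow>
      (P_position {#a, b, 1#} \<longleftrightarrow>
        real (a XOR b) = 2 + (-1) powi \<lfloor>log 2 (real a / 7)\<rfloor>))"
proof (intro conjI impI)
  show "P_position {#a, b, 1#} \<longleftrightarrow> b = phi1 a"
    by (rule P_position_third_pile_1)
  assume "14 \<le> a \<and> 14 \<le> b"
  then have a: "14 \<le> a" by simp
  have xor_eq_iff: "b = a XOR c \<longleftrightarrow> a XOR b = c" for c
    by (auto simp flip: xor.assoc)
  \<comment> \<open>The values \<open>2 + 1\<close> and \<open>2 - 1\<close> are exactly the XOR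
    masks of \<open>phi1\<close> on even and odd levels.\<close>
  have "2 + (-1) powi \<lfloor>log 2 (real a / 7)\<rfloor> = real (if even_level a then 3 else 1)"
    using a by (simp add: minus_one_powi_floor_log)
  then have "real (a XOR b) = 2 + (-1) powi \<lfloor>log 2 (real a / 7)\<rfloor> \<longleftrightarrow>
      a XOR b = (if even_level a then 3 else 1)"
    by (simp only: of_nat_eq_iff)
  then show "P_position {#a, b, 1#} \<longleftrightarrow>
      real (a XOR b) = 2 + (-1) powi \<lfloor>log 2 (real a / 7)\<rfloor>"
    using a by (simp only: P_position_third_pile_1 phi1_ge_14 xor_eq_iff)
qed

end
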